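(* The 4-point SBIGS-scheme (spherical angle-based 4-point scheme) on the unit sphere $\mathbb{S}^2$ is convergent and $G^1$-continuous: for every initial geodesic polygon $P^0=(p_i^0)_{i\in\mathbb{Z}}$ on $\mathbb{S}^2$, the sequence of geodesic polygons $P^j$ generated by the scheme converges to a limit curve, and this limit curve is $G^1$-continuous.
   Context: $\mathbb{S}^2\subset\mathbb{R}^3$ is the oriented unit sphere with centre $o$, and $d$ is its geodesic distance. A geodesic polygon $P=(p_i)_{i\in\mathbb{Z}}$ is a sequence of points of $\mathbb{S}^2$ with consecutive points distinct and non-antipodal, consecutive points being joined by the minimizing great-circle arc. Closed polygons correspond to periodic sequences. For a polygon $P^j=(p_i^j)_{i\in\mathbb{Z}}$ let $l_{i,i+1}^j=e_i^j=d(p_i^j,p_{i+1}^j)$, let $c_{i,i+1}^j$ be the unit-speed minimizing geodesic from $p_i^j$ to $p_{i+1}^j$, and put $U_i^j=\dot c_{i,i+1}^j(0)$ and $V_i^j=\dot c_{i-1,i}^j(l_{i-1,i}^j)$, two unit vectors in $T_{p_i^j}\mathbb{S}^2$. The signed angular defect at $p_i^j$ is the signed angle $\delta_i^j=\sphericalangle(U_i^j,V_i^j)\in(-\pi,\pi]$ from $U_i^j$ to $V_i^j$, with respect to the orientation of the sphere by its outward normal. 4-point SBIGS-scheme (SBIGS = Spherical Bisector Interpolatory Geometric Subdivision): given $P^j$, the polygon $P^{j+1}$ is defined by $p_{2i}^{j+1}=p_i^j$ and $$p_{2i+1}^{j+1}=R_{\vec n,\,e_{2i}^{j+1}}\big(\overrightarrow{op_i^j}\big),\qquad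 \vec n=\overrightarrow{op_i^j}\wedge\big(R_{p_i^j,\,\alpha_{2i+1}^{j+1}}U_i^j\big),$$ $$e_{2i}^{j+1}=\arctan\left(\frac{\tan(l_{i,i+1}^j/2)}{\cos(\alpha_{2i+1}^{j+1})}\right),\qquad \alpha_{2i+1}^{j+1}=\frac{\delta_i^j+\delta_{i+1}^j}{8},$$ where $R_{v,\theta}$ denotes the rotation of $\mathbb{R}^3$ about the oriented axis $v$ by angle $\theta$. Equivalently, $p_{2i+1}^{j+1}$ is the apex of the isosceles spherical triangle with base $p_i^jp_{i+1}^j$ and both signed base angles equal to $\alpha_{2i+1}^{j+1}$ (the midpoint of the arc if this angle is $0$). Convergence means that the geodesic polygons $P^j$, each parametrized as the curve $c^j:\mathbb{R}\to\mathbb{S}^2$ with $c^j(i/2^j)=p_i^j$ and constant speed on each interval $[i/2^j,(i+1)/2^j]$, converge uniformly to a continuous limit curve. The limit curve is $G^1$-continuous if it has at each of its points a well-defined oriented tangent direction which varies continuously along the curve (equivalently, its arc-length parametrization is $C^1$). *)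

theory Defs
  imports "HOL-Analysis.Analysis"
begin

text \<open>The sphere is \<^term>\<open>sphere 0 1 :: (real^3) set\<close>, so a point \<open>p\<close> is also the vector
  \<open>op\<close> and the outward unit normal at \<open>p\<close>.\<close>

definition geodesic_dist :: "real^3 \<Rightarrow> real^3 \<Rightarrow> real" where
  "geodesic_dist p q = arccos (p \<bullet> q)"

definition geodesic_polygon :: "(int \<Rightarrow> real^3) \<Rightarrow> bool" where
  "geodesic_polygon P \<longleftrightarrow> (\<forall>i. P i \<in> sphere 0 1 \<and> P (i + 1) \<noteq> P i \<and> P (i + 1) \<noteq> - P i)"

text \<open>The unit-speed minimizing geodesic from \<open>p\<close> to \<open>q\<close> (for \<open>q \<noteq> p\<close>, \<open>q \<noteq> - p\<close>), with parameter
  range \<^term>\<open>{0..geodesic_dist p q}\<close>. The formula also makes sense outside this range, where it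
  continues along the same great circle; thus the velocities at the two ends are ordinary
  two-sided derivatives.\<close>

definition geodesic :: "real^3 \<Rightarrow> real^3 \<Rightarrow> real \<Rightarrow> real^3" where
  "geodesic p q s =
     (let l = geodesic_dist p q in (sin (l - s) / sin l) *\<^sub>R p + (sin s / sin l) *\<^sub>R q)"

definition edge_length :: "(int \<Rightarrow> real^3) \<Rightarrow> int \<Rightarrow> real" where
  "edge_length P i = geodesic_dist (P i) (P (i + 1))"

definition outgoing_dir :: "(int \<Rightarrow> real^3) \<Rightarrow> int \<Rightarrow> real^3" where
  "outgoing_dir P i = vector_derivative (geodesic (P i) (P (i + 1))) (at 0)"

definition incoming_dir :: "(int \<Rightarrow> real^3) \<Rightarrow> int \<Rightarrow> real^3" where
  "incoming_dir P i = vector_derivative (geodesic (P (i - 1)) (P i)) (at (edge_length P (i - 1)))"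

text \<open>Rotation by \<open>\<theta>\<close> about the oriented axis \<open>v \<noteq> 0\<close> (Rodrigues' formula; the axis vector need not
  be normalized).\<close>

definition rotation :: "real^3 \<Rightarrow> real \<Rightarrow> real^3 \<Rightarrow> real^3" where
  "rotation v \<theta> x =
     (let n = sgn v in
       cos \<theta> *\<^sub>R x + sin \<theta> *\<^sub>R cross3 n x + ((1 - cos \<theta>) * (n \<bullet> x)) *\<^sub>R n)"

text \<open>The signed angle in \<open>(-\<pi>, \<pi>]\<close> from \<open>u\<close> to \<open>v\<close>, two unit vectors orthogonal to the unit vector
  \<open>p\<close>: the pairs \<open>(u \<bullet> u, p \<bullet> (u \<times> u)) = (1, 0)\<close> and \<open>(u \<bullet> v, p \<bullet> (u \<times> v))\<close> are the coordinates of \<open>u\<close>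
  and \<open>v\<close> in the positively oriented orthonormal basis \<open>u, p \<times> u\<close> of the tangent plane at \<open>p\<close>.\<close>

definition signed_angle :: "real^3 \<Rightarrow> real^3 \<Rightarrow> real^3 \<Rightarrow> real" where
  "signed_angle p u v = Arg (Complex (u \<bullet> v) (p \<bullet> cross3 u v))"

lemma rotation_signed_angle:
  assumes "norm p = 1" "norm u = 1" "norm v = 1" "p \<bullet> u = 0" "p \<bullet> v = 0"
  shows "rotation p (signed_angle p u v) u = v"
proof -
  define a b where "a = u \<bullet> v" and "b = p \<bullet> cross3 u v"
  have *: "p $ 1 * p $ 1 + p $ 2 * p $ 2 + p $ 3 * p $ 3 = 1" "u $ 1 * u $ 1 + u $ 2 * u $ 2 + u $ 3 * u $ 3 = 1"
     "v $ 1 * v $ 1 + v $ 2 * v $ 2 + v $ 3 * v $ 3 = 1"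
     "p $ 1 * u $ 1 + p $ 2 * u $ 2 + p $ 3 * u $ 3 = 0" "p $ 1 * v $ 1 + p $ 2 * v $ 2 + p $ 3 * v $ 3 = 0"
    using assms by (simp_all add: norm_eq_1 inner_vec_def sum_3)
  have v: "v = a *\<^sub>R u + b *\<^sub>R cross3 p u"
    unfolding a_def b_def vec_eq_iff forall_3
    by (simp add: cross3_def inner_vec_def sum_3; intro conjI; use * in algebra)
  have n: "norm (Complex a b) = 1"
  proof -
    have "a^2 + b^2 = 1"
      unfolding a_def b_def by (simp add: cross3_def inner_vec_def sum_3; use * in algebra)
    thus ?thesis by (simp add: complex_norm)
  qed
  have "cis (Arg (Complex a b)) = Complex a b"
    using n by (metis cis_Arg norm_zero zero_neq_one sgn_div_norm inverse_1 scaleR_one)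
  hence "cos (signed_angle p u v) = a" "sin (signed_angle p u v) = b"
    unfolding signed_angle_def a_def b_def by (simp_all add: complex_eq_iff)
  thus ?thesis
    using v assms by (simp add: rotation_def sgn_div_norm)
qed

definition angular_defect :: "(int \<Rightarrow> real^3) \<Rightarrow> int \<Rightarrow> real" where
  "angular_defect P i = signed_angle (P i) (outgoing_dir P i) (incoming_dir P i)"

definition sbigs_base_angle :: "(int \<Rightarrow> real^3) \<Rightarrow> int \<Rightarrow> real" where
  "sbigs_base_angle P i = (angular_defect P i + angular_defect P (i + 1)) / 8"

definition sbigs_new_length :: "(int \<Rightarrow> real^3) \<Rightarrow> int \<Rightarrow> real" where
  "sbigs_new_length P i = arctan (tan (edge_length P i / 2) / cos (sbigs_base_angle P i))"

definition sbigs_new_point :: "(int \<Rightarrow> real^3) \<Rightarrow> int \<Rightarrow> real^3" where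
  "sbigs_new_point P i =
     (let n = cross3 (P i) (rotation (P i) (sbigs_base_angle P i) (outgoing_dir P i))
      in rotation n (sbigs_new_length P i) (P i))"

text \<open>On \<^typ>\<open>int\<close>, \<open>div\<close> rounds downwards, so that \<open>(2 * i + 1) div 2 = i\<close> for negative \<open>i\<close> as well.\<close>

definition sbigs_step :: "(int \<Rightarrow> real^3) \<Rightarrow> int \<Rightarrow> real^3" where
  "sbigs_step P k = (if even k then P (k div 2) else sbigs_new_point P (k div 2))"

definition sbigs :: "(int \<Rightarrow> real^3) \<Rightarrow> nat \<Rightarrow> int \<Rightarrow> real^3" where
  "sbigs P0 j = (sbigs_step ^^ j) P0"

text \<open>The curve with value \<open>P i\<close> at \<open>i / 2 ^ j\<close>, running at constant speed along each edge.\<close>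

definition polygon_curve :: "nat \<Rightarrow> (int \<Rightarrow> real^3) \<Rightarrow> real \<Rightarrow> real^3" where
  "polygon_curve j P t =
     (let i = \<lfloor>2 ^ j * t\<rfloor>
      in geodesic (P i) (P (i + 1)) ((2 ^ j * t - of_int i) * edge_length P i))"

text \<open>\<open>T\<close> is the oriented unit tangent direction of \<open>c\<close> at parameter \<open>t\<close>: the common limit of the
  directions of the secants through \<open>c t\<close> from both sides, each oriented by increasing parameter.
  Since \<open>sgn 0 = 0\<close>, the limit being a unit vector forces \<open>c s \<noteq> c t\<close> for all \<open>s \<noteq> t\<close> near \<open>t\<close>.
  No differentiability of the given parametrization is required.\<close>

definition has_tangent_direction :: "(real \<Rightarrow> real^3) \<Rightarrow> real^3 \<Rightarrow> real \<Rightarrow> bool" where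
  "has_tangent_direction c T t \<longleftrightarrow>
     norm T = 1 \<and> ((\<lambda>s. sgn (s - t) *\<^sub>R sgn (c s - c t)) \<longlongrightarrow> T) (at t)"

definition G1_continuous :: "(real \<Rightarrow> real^3) \<Rightarrow> bool" where
  "G1_continuous c \<longleftrightarrow>
     (\<exists>T. continuous_on UNIV T \<and> (\<forall>t. has_tangent_direction c (T t) t))"

end

theory Submission
  imports Defs
begin

text \<open>
  Three estimates, each with a geometric rate, and one convexity argument carry the proof.

  \<^emph>\<open>Edges shrink.\<close> Every base angle satisfies \<open>\<bar>\<alpha>\<bar> \<le> \<pi> / 4\<close>, being an eighth of a sum of two
  defects, and \<open>arctan (s tan x) \<le> s x\<close> for \<open>s \<ge> 1\<close>. Hence a new edge has length at most
  \<open>l / (2 cos \<alpha>) \<le> l / sqrt 2\<close>, so the edge lengths decay geometrically, uniformly over the possibly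
  infinite polygon. This already gives uniform convergence to a continuous curve.

  \<^emph>\<open>Defects shrink.\<close> At an old vertex the two base angles are cut off, so that the new defect is
  exactly \<open>(- \<delta>\<^bsub>i-1\<^esub> + 6 \<delta>\<^bsub>i\<^esub> - \<delta>\<^bsub>i+1\<^esub>) / 8\<close>. At a new vertex a planar isosceles triangle would have the
  exterior angle \<open>2 \<alpha>\<close>; positive curvature only lowers its modulus. So the defect there is at most
  half of the largest old defect. The rule at old vertices alone does not contract, as
  \<open>(1 + 6 + 1) / 8 = 1\<close>, but from the first step on every second vertex is a new one and has a smaller
  defect. Holding the odd vertices to \<open>2 / 3\<close> of the bound for all vertices makes the bound
  contract by \<open>11 / 12\<close> in each step (\<open>sbigs_angular_defect_decay\<close>).

  \<^emph>\<open>Directions converge.\<close> One step turns the direction of an edge by an angle bounded by base angles,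
  defects and edge lengths, and neighbouring edges differ in direction by the defect between them
  and an edge length. Therefore the edge directions converge uniformly, at a geometric rate, to a
  continuous field \<open>T\<close> (\<open>dyadic_steps_converge\<close>, which also yields the limit curve).

  It remains to see that \<open>T\<close> is tangent to the limit curve, although nothing is known about the speed
  of its parametrization. The vectors that make a small angle with \<open>T t\<close> form a closed convex cone.
  Near \<open>t\<close> all fine edges lie in it, hence so do their sums and the limits of these sums, which are
  the secants of the limit curve. A secant spans some edge of a fine polygon, whose end
  points stay on all later polygons; this edge prevents the secant from vanishing
  (\<open>dyadic_tangent_direction\<close>).
\<close>

section \<open>Edges of geodesic polygons\<close>

definition spherical_edge :: "real^3 \<Rightarrow> real^3 \<Rightarrow> bool" where
  "spherical_edge p q \<longleftrightarrow> norm p = 1 \<and> norm q = 1 \<and> q \<noteq> p \<and> q \<noteq> - p"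

text \<open>The velocity of the geodesic from \<open>p\<close> at \<open>p\<close>, written without a derivative. Both directions at a
  vertex are expressed by it: the incoming one is minus the direction back along the edge.\<close>

definition start_dir :: "real^3 \<Rightarrow> real^3 \<Rightarrow> real^3" where
  "start_dir p q = (1 / sin (geodesic_dist p q)) *\<^sub>R (q - cos (geodesic_dist p q) *\<^sub>R p)"

lemma geodesic_polygon_edge:
  "geodesic_polygon P \<Longrightarrow> spherical_edge (P i) (P (i + 1))"
  by (auto simp: geodesic_polygon_def spherical_edge_def)

lemma geodesic_dist_commute: "geodesic_dist p q = geodesic_dist q p"
  by (simp add: geodesic_dist_def inner_commute)

lemma spherical_edge_commute: "spherical_edge p q \<longleftrightarrow> spherical_edge q p"
  by (auto simp: spherical_edge_def)

lemma spherical_edge_dist: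
  assumes "spherical_edge p q"
  shows "0 < geodesic_dist p q" "geodesic_dist p q < pi" "cos (geodesic_dist p q) = p \<bullet> q"
    "0 < sin (geodesic_dist p q)"
proof -
  have n: "norm p = 1" "norm q = 1" "q \<noteq> p" "q \<noteq> - p"
    using assms by (auto simp: spherical_edge_def)
  have "\<bar>p \<bullet> q\<bar> \<noteq> 1"
    using n norm_cauchy_schwarz_abs_eq[of p q] by auto
  moreover have "\<bar>p \<bullet> q\<bar> \<le> 1"
    using n Cauchy_Schwarz_ineq2[of p q] by simp
  ultimately have *: "- 1 < p \<bullet> q" "p \<bullet> q < 1" by linarith+
  show "0 < geodesic_dist p q" "geodesic_dist p q < pi" "cos (geodesic_dist p q) = p \<bullet> q"
    using arccos_lt_bounded[OF *] * by (auto simp: geodesic_dist_def)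
  thus "0 < sin (geodesic_dist p q)" by (simp add: sin_gt_zero)
qed

lemma start_dir:
  assumes "spherical_edge p q"
  shows "norm (start_dir p q) = 1" "p \<bullet> start_dir p q = 0"
    "cos (geodesic_dist p q) *\<^sub>R p + sin (geodesic_dist p q) *\<^sub>R start_dir p q = q"
proof -
  let ?l = "geodesic_dist p q"
  note d = spherical_edge_dist[OF assms]
  have n: "p \<bullet> p = 1" "q \<bullet> q = 1"
    using assms by (auto simp: spherical_edge_def norm_eq_1)
  have "(q - cos ?l *\<^sub>R p) \<bullet> (q - cos ?l *\<^sub>R p) = 1 - (cos ?l)\<^sup>2"
    using n d(3) by (simp add: inner_diff inner_commute power2_eq_square)
  hence "start_dir p q \<bullet> start_dir p q = 1"
    using d(4) unfolding start_dir_def by (simp flip: sin_squared_eq) (simp add: power2_eq_square)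
  thus "norm (start_dir p q) = 1" by (simp add: norm_eq_1)
  show "p \<bullet> start_dir p q = 0"
    using n d(3) by (simp add: start_dir_def inner_diff)
  show "cos ?l *\<^sub>R p + sin ?l *\<^sub>R start_dir p q = q"
    using d(4) by (simp add: start_dir_def)
qed

lemma geodesic_eq:
  assumes "spherical_edge p q"
  shows "geodesic p q s = cos s *\<^sub>R p + sin s *\<^sub>R start_dir p q"
proof -
  have "geodesic p q s = (sin (geodesic_dist p q - s) / sin (geodesic_dist p q)) *\<^sub>R p
      + (sin s / sin (geodesic_dist p q)) *\<^sub>R
        (cos (geodesic_dist p q) *\<^sub>R p + sin (geodesic_dist p q) *\<^sub>R start_dir p q)"
    using start_dir(3)[OF assms] by (simp add: geodesic_def Let_def)
  also have "\<dots> = cos s *\<^sub>R p + sin s *\<^sub>R start_dir p q"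
    using spherical_edge_dist(4)[OF assms]
    by (simp add: scaleR_add_right scaleR_add_left[symmetric] add.assoc[symmetric] sin_diff field_simps)
  finally show ?thesis .
qed

lemma geodesic_velocity:
  assumes "spherical_edge p q"
  shows "vector_derivative (geodesic p q) (at s) = cos s *\<^sub>R start_dir p q - sin s *\<^sub>R p"
proof (rule vector_derivative_at)
  have "geodesic p q = (\<lambda>s. cos s *\<^sub>R p + sin s *\<^sub>R start_dir p q)"
    using geodesic_eq[OF assms] by blast
  then show "(geodesic p q has_vector_derivative cos s *\<^sub>R start_dir p q - sin s *\<^sub>R p) (at s)"
    by (auto intro!: derivative_eq_intros has_vector_derivative_real_field simp: has_real_derivative_iff_has_vector_derivative[symmetric])
qed

lemma outgoing_dir_eq:
  "geodesic_polygon P \<Longrightarrow> outgoing_dir P i = start_dir (P i) (P (i + 1))"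
  unfolding outgoing_dir_def by (simp add: geodesic_velocity geodesic_polygon_edge)

lemma end_velocity:
  assumes "spherical_edge p q"
  shows "cos (geodesic_dist p q) *\<^sub>R start_dir p q - sin (geodesic_dist p q) *\<^sub>R p = - start_dir q p"
proof -
  let ?c = "cos (geodesic_dist p q)" and ?s = "sin (geodesic_dist p q)"
  let ?U = "start_dir p q"
  have s: "?s > 0" using spherical_edge_dist[OF assms] by simp
  have q: "q = ?c *\<^sub>R p + ?s *\<^sub>R ?U" using start_dir(3)[OF assms] by simp
  have "?s *\<^sub>R start_dir q p = p - ?c *\<^sub>R q"
    using s by (simp add: start_dir_def geodesic_dist_commute[of q p])
  also have "\<dots> = (1 - ?c * ?c) *\<^sub>R p - (?c * ?s) *\<^sub>R ?U"
    by (subst q) (simp add: algebra_simps)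
  also have "1 - ?c * ?c = ?s * ?s"
    using sin_cos_squared_add[of "geodesic_dist p q"] by (simp add: power2_eq_square)
  finally have "?s *\<^sub>R start_dir q p = ?s *\<^sub>R (?s *\<^sub>R p - ?c *\<^sub>R ?U)"
    by (simp add: algebra_simps)
  hence "start_dir q p = ?s *\<^sub>R p - ?c *\<^sub>R ?U" using s by simp
  thus ?thesis by simp
qed

lemma incoming_dir_eq:
  assumes "geodesic_polygon P"
  shows "incoming_dir P i = - start_dir (P i) (P (i - 1))"
proof -
  have e: "spherical_edge (P (i - 1)) (P i)"
    using geodesic_polygon_edge[OF assms, of "i - 1"] by simp
  show ?thesis
    unfolding incoming_dir_def edge_length_def geodesic_velocity[OF e]
    using end_velocity[OF e] by simp
qed

lemma outgoing_incoming_dir: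
  assumes "geodesic_polygon P"
  shows "norm (P i) = 1" "norm (outgoing_dir P i) = 1" "norm (incoming_dir P i) = 1"
    "P i \<bullet> outgoing_dir P i = 0" "P i \<bullet> incoming_dir P i = 0"
proof -
  have e: "spherical_edge (P i) (P (i + 1))" "spherical_edge (P i) (P (i - 1))"
    using geodesic_polygon_edge[OF assms, of i] geodesic_polygon_edge[OF assms, of "i - 1"]
      spherical_edge_commute by auto
  show "norm (P i) = 1" using e by (simp add: spherical_edge_def)
  show "norm (outgoing_dir P i) = 1" "norm (incoming_dir P i) = 1"
    "P i \<bullet> outgoing_dir P i = 0" "P i \<bullet> incoming_dir P i = 0"
    using start_dir[OF e(1)] start_dir[OF e(2)]
    by (simp_all add: outgoing_dir_eq[OF assms] incoming_dir_eq[OF assms])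
qed

text \<open>A point given in polar coordinates about \<open>p\<close>: distance and direction can be read off. The new
  vertices are known in this form from both ends of the edge that they replace.\<close>

lemma geodesic_polar:
  assumes "norm p = 1" "norm w = 1" "p \<bullet> w = 0" "0 < e" "e < pi" "q = cos e *\<^sub>R p + sin e *\<^sub>R w"
  shows "spherical_edge p q" "geodesic_dist p q = e" "start_dir p q = w"
proof -
  have n: "p \<bullet> p = 1" "w \<bullet> w = 1" using assms by (auto simp: norm_eq_1)
  have s: "sin e > 0" using assms by (simp add: sin_gt_zero)
  have pq: "p \<bullet> q = cos e" using assms(3,6) n by (simp add: inner_add)
  have "q \<bullet> q = 1" using assms(3,6) n
    by (simp add: inner_add inner_commute[of w p] power2_eq_square[symmetric])
  moreover have "q \<bullet> w = sin e" using assms(3,6) n by (simp add: inner_add)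
  ultimately show "spherical_edge p q"
    using assms(1,3) s by (auto simp: spherical_edge_def norm_eq_1)
  show d: "geodesic_dist p q = e"
    using assms pq by (simp add: geodesic_dist_def arccos_cos)
  show "start_dir p q = w"
    unfolding start_dir_def d using s by (simp add: assms(6))
qed

text \<open>A chord of the unit circle is shorter than its arc. All later estimates of differences of
  directions rest on this.\<close>

lemma norm_diff_le_angle:
  fixes x y :: "'a :: real_inner"
  assumes "norm x = 1" "norm y = 1" "x \<bullet> y = cos \<theta>"
  shows "norm (x - y) \<le> \<bar>\<theta>\<bar>"
proof -
  have "(norm (x - y))\<^sup>2 = 2 - 2 * cos \<theta>"
    using assms unfolding dot_norm_neg by simp
  also have "\<dots> = (2 * sin (\<theta> / 2))\<^sup>2"
    using cos_double_sin[of "\<theta> / 2"] by (simp add: power_mult_distrib)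
  also have "\<dots> \<le> \<theta>\<^sup>2"
    using abs_sin_x_le_abs_x[of "\<theta> / 2"] by (subst abs_le_square_iff[symmetric]) simp
  finally have "(norm (x - y))\<^sup>2 \<le> \<bar>\<theta>\<bar>\<^sup>2" by simp
  thus ?thesis by (rule power2_le_imp_le) simp
qed

lemma geodesic_near_start:
  assumes "spherical_edge p q"
  shows "norm (geodesic p q s - p) \<le> \<bar>s\<bar>"
proof (rule norm_diff_le_angle)
  have n: "p \<bullet> p = 1" "start_dir p q \<bullet> start_dir p q = 1" "p \<bullet> start_dir p q = 0"
    using assms start_dir[OF assms] by (auto simp: spherical_edge_def norm_eq_1)
  show "norm p = 1" using assms by (simp add: spherical_edge_def)
  show "norm (geodesic p q s) = 1"
    unfolding norm_eq_1 geodesic_eq[OF assms] using n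
    by (simp add: inner_add inner_commute[of "start_dir p q" p] power2_eq_square[symmetric])
  show "geodesic p q s \<bullet> p = cos s"
    unfolding geodesic_eq[OF assms] using n by (simp add: inner_add inner_commute)
qed

lemma spherical_edge_norm_diff:
  assumes "spherical_edge p q"
  shows "norm (q - p) \<le> geodesic_dist p q"
  using geodesic_near_start[OF assms, of "geodesic_dist p q"] geodesic_eq[OF assms]
    start_dir(3)[OF assms] spherical_edge_dist(1)[OF assms] by simp

text \<open>A unit vector tangent to a great circle turns in space by the length of the arc travelled.\<close>

lemma end_velocity_near_start_dir:
  assumes "spherical_edge p q"
  shows "norm (- start_dir q p - start_dir p q) \<le> geodesic_dist p q"
proof -
  have "norm (- start_dir q p - start_dir p q) \<le> \<bar>geodesic_dist p q\<bar>"
  proof (rule norm_diff_le_angle)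
    show "norm (- start_dir q p) = 1" "norm (start_dir p q) = 1"
      using assms start_dir spherical_edge_commute by auto
    show "- start_dir q p \<bullet> start_dir p q = cos (geodesic_dist p q)"
      using start_dir[OF assms]
      by (simp add: end_velocity[OF assms, symmetric] inner_diff norm_eq_1)
  qed
  thus ?thesis using spherical_edge_dist[OF assms] by simp
qed

text \<open>The chord makes an angle of half the arc length with the tangent at its start.\<close>

lemma chord_near_start_dir:
  assumes "spherical_edge p q"
  shows "norm (sgn (q - p) - start_dir p q) \<le> geodesic_dist p q"
proof -
  let ?l = "geodesic_dist p q" and ?U = "start_dir p q"
  note d = spherical_edge_dist[OF assms]
  have n: "p \<bullet> p = 1" "q \<bullet> q = 1" "norm ?U = 1" "p \<bullet> ?U = 0" "q \<noteq> p"
    using assms start_dir[OF assms] by (auto simp: spherical_edge_def norm_eq_1)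
  have s: "sin (?l / 2) > 0" using d by (simp add: sin_gt_zero)
  have "(norm (q - p))\<^sup>2 = 2 - 2 * cos ?l"
    using n d(3) by (simp add: power2_norm_eq_inner inner_diff inner_commute)
  also have "\<dots> = (2 * sin (?l / 2))\<^sup>2"
    using cos_double_sin[of "?l / 2"] by (simp add: power_mult_distrib)
  finally have len: "norm (q - p) = 2 * sin (?l / 2)"
    by (rule power2_eq_imp_eq) (use s in simp_all)
  have "(q - p) \<bullet> ?U = sin ?l"
  proof -
    have "q \<bullet> ?U = (cos ?l *\<^sub>R p + sin ?l *\<^sub>R ?U) \<bullet> ?U" using start_dir(3)[OF assms] by simp
    thus ?thesis using n by (simp add: inner_add inner_diff norm_eq_1)
  qed
  also have "sin ?l = 2 * sin (?l / 2) * cos (?l / 2)" using sin_double[of "?l / 2"] by simp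
  finally have "sgn (q - p) \<bullet> ?U = cos (?l / 2)" using s by (simp add: sgn_div_norm len)
  hence "norm (sgn (q - p) - ?U) \<le> \<bar>?l / 2\<bar>"
    using n by (intro norm_diff_le_angle) (auto simp: norm_sgn)
  thus ?thesis using d by simp
qed

section \<open>Rotations of tangent vectors\<close>

lemma rotation_tangent:
  assumes "norm p = 1" "p \<bullet> u = 0"
  shows "rotation p \<theta> u = cos \<theta> *\<^sub>R u + sin \<theta> *\<^sub>R cross3 p u"
  using assms by (simp add: rotation_def sgn_div_norm)

lemma cross3_unit_tangent:
  assumes "norm p = 1" "p \<bullet> u = 0"
  shows "cross3 p (cross3 p u) = - u" "cross3 (cross3 p u) p = u"
proof -
  show *: "cross3 p (cross3 p u) = - u"
    using assms by (simp add: Lagrange norm_eq_1)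
  show "cross3 (cross3 p u) p = u"
    using * cross_skew[of "cross3 p u" p] by simp
qed

lemma rotation_tangent_orthogonal:
  assumes "norm p = 1" "p \<bullet> u = 0"
  shows "p \<bullet> rotation p \<theta> u = 0"
  using assms by (simp add: rotation_tangent inner_add_right dot_cross_self)

lemma rotation_tangent_inner:
  assumes "norm p = 1" "norm u = 1" "p \<bullet> u = 0"
  shows "u \<bullet> rotation p \<theta> u = cos \<theta>"
  using assms by (simp add: rotation_tangent inner_add_right dot_cross_self norm_eq_1)

lemma norm_rotation_tangent:
  assumes "norm p = 1" "norm u = 1" "p \<bullet> u = 0"
  shows "norm (rotation p \<theta> u) = 1"
proof -
  have "cross3 p u \<bullet> cross3 p u = 1"
    using assms norm_cross_dot[of p u] by (simp add: power2_norm_eq_inner)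
  moreover have "u \<bullet> cross3 p u = 0" "cross3 p u \<bullet> u = 0" by (simp_all add: dot_cross_self)
  ultimately have "rotation p \<theta> u \<bullet> rotation p \<theta> u = (cos \<theta>)\<^sup>2 + (sin \<theta>)\<^sup>2"
    using assms by (simp add: rotation_tangent inner_add norm_eq_1 power2_eq_square)
  thus ?thesis by (simp add: norm_eq_1)
qed

lemma rotation_rotation_tangent:
  assumes "norm p = 1" "p \<bullet> u = 0"
  shows "rotation p \<beta> (rotation p \<alpha> u) = rotation p (\<alpha> + \<beta>) u"
proof -
  have "cross3 p (rotation p \<alpha> u) = cos \<alpha> *\<^sub>R cross3 p u - sin \<alpha> *\<^sub>R u"
    using assms cross3_unit_tangent(1)[OF assms]
    by (simp add: rotation_tangent cross_add_right cross_mult_right)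
  thus ?thesis
    using assms rotation_tangent_orthogonal[OF assms]
    by (simp add: rotation_tangent[of p "rotation p \<alpha> u"])
      (simp add: rotation_tangent sin_add cos_add algebra_simps)
qed

lemma rotation_minus_tangent:
  assumes "norm p = 1" "p \<bullet> u = 0"
  shows "rotation p \<theta> (- u) = - rotation p \<theta> u"
  using assms by (simp add: rotation_tangent cross_minus_right)

lemma signed_angle_bounds: "- pi < signed_angle p u v" "signed_angle p u v \<le> pi"
  using Arg_bounded unfolding signed_angle_def by auto

lemma cos_signed_angle:
  assumes "norm p = 1" "norm u = 1" "norm v = 1" "p \<bullet> u = 0" "p \<bullet> v = 0"
  shows "cos (signed_angle p u v) = u \<bullet> v"
  using rotation_tangent_inner[OF assms(1,2,4)] rotation_signed_angle[OF assms] by metis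

lemma signed_angle_rotation:
  assumes "norm p = 1" "norm u = 1" "p \<bullet> u = 0" "- pi < \<theta>" "\<theta> \<le> pi"
  shows "signed_angle p u (rotation p \<theta> u) = \<theta>"
proof -
  have "p \<bullet> cross3 u (rotation p \<theta> u) = sin \<theta>"
  proof -
    have "p \<bullet> cross3 u (cross3 p u) = 1"
      using assms by (simp add: Lagrange norm_eq_1 inner_commute[of u p])
    thus ?thesis using assms by (simp add: rotation_tangent cross_add_right cross_mult_right inner_add_right)
  qed
  hence "signed_angle p u (rotation p \<theta> u) = Arg (cis \<theta>)"
    using rotation_tangent_inner[OF assms(1-3)] by (simp add: signed_angle_def cis.ctr)
  thus ?thesis using assms by (simp add: Arg_cis)
qed

text \<open>Signed angles are additive as long as the sum stays in the branch \<open>(-\<pi>, \<pi>]\<close>.\<close>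

lemma signed_angle_rotation_rotation:
  assumes "norm p = 1" "norm u = 1" "norm v = 1" "p \<bullet> u = 0" "p \<bullet> v = 0"
    and "- pi < signed_angle p u v + \<beta> - \<alpha>" "signed_angle p u v + \<beta> - \<alpha> \<le> pi"
  shows "signed_angle p (rotation p \<alpha> u) (rotation p \<beta> v) = signed_angle p u v + \<beta> - \<alpha>"
proof -
  let ?w = "rotation p \<alpha> u"
  have w: "norm ?w = 1" "p \<bullet> ?w = 0"
    using assms norm_rotation_tangent rotation_tangent_orthogonal by auto
  have "rotation p \<beta> v = rotation p (signed_angle p u v + \<beta>) u"
    using rotation_signed_angle[OF assms(1-5)] rotation_rotation_tangent[OF assms(1,4)] by metis
  also have "\<dots> = rotation p (signed_angle p u v + \<beta> - \<alpha>) ?w"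
    using assms by (simp add: rotation_rotation_tangent)
  finally show ?thesis using signed_angle_rotation[OF assms(1) w assms(6,7)] by simp
qed

section \<open>One subdivision step\<close>

lemma angular_defect_bound: "\<bar>angular_defect P i\<bar> \<le> pi"
  using signed_angle_bounds[of "P i" "outgoing_dir P i" "incoming_dir P i"]
  by (simp add: angular_defect_def)

lemma sbigs_base_angle_bound: "\<bar>sbigs_base_angle P i\<bar> \<le> pi / 4"
  using angular_defect_bound[of P i] angular_defect_bound[of P "i + 1"]
  by (simp add: sbigs_base_angle_def)

lemma cos_sbigs_base_angle: "sqrt 2 / 2 \<le> cos (sbigs_base_angle P i)"
proof -
  have "cos (pi / 4) \<le> cos \<bar>sbigs_base_angle P i\<bar>"
    using sbigs_base_angle_bound[of P i] pi_gt_zero by (intro cos_monotone_0_pi_le) linarith+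
  thus ?thesis by (simp add: cos_45)
qed

text \<open>The function \<open>x \<mapsto> arctan (s tan x)\<close> vanishes at \<open>0\<close> and has the derivative
  \<open>s / (cos\<^sup>2 x + s\<^sup>2 sin\<^sup>2 x)\<close>, whose denominator is at least \<open>1\<close>.\<close>

lemma arctan_mult_tan_le:
  assumes "1 \<le> s" "0 \<le> x" "x < pi / 2"
  shows "arctan (s * tan x) \<le> s * x"
proof -
  have "s * 0 - arctan (s * tan 0) \<le> s * x - arctan (s * tan x)"
  proof (rule DERIV_nonneg_imp_nondecreasing[OF assms(2)])
    fix y assume y: "0 \<le> y" "y \<le> x"
    have c: "cos y > 0" using y assms(3) by (intro cos_gt_zero_pi) linarith+
    have "((\<lambda>x. s * x - arctan (s * tan x)) has_real_derivative
        s - inverse (1 + (s * tan y)\<^sup>2) * (s * inverse ((cos y)\<^sup>2))) (at y)"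
      using c by (auto intro!: derivative_eq_intros)
    moreover have "inverse (1 + (s * tan y)\<^sup>2) * (s * inverse ((cos y)\<^sup>2)) \<le> s * 1"
    proof -
      have "(1 + (s * tan y)\<^sup>2) * (cos y)\<^sup>2 = (cos y)\<^sup>2 + s\<^sup>2 * (sin y)\<^sup>2"
        using c by (simp add: tan_def field_simps)
      also have "\<dots> \<ge> (cos y)\<^sup>2 + 1 * (sin y)\<^sup>2"
        using assms(1) by (intro add_left_mono mult_right_mono) (simp_all add: one_le_power)
      finally have "1 \<le> (1 + (s * tan y)\<^sup>2) * (cos y)\<^sup>2" by simp
      hence "inverse ((1 + (s * tan y)\<^sup>2) * (cos y)\<^sup>2) \<le> 1" by (rule inverse_le_1_iff[THEN iffD2, OF disjI2])
      hence "s * inverse ((1 + (s * tan y)\<^sup>2) * (cos y)\<^sup>2) \<le> s * 1"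
        using assms(1) by (intro mult_left_mono) auto
      thus ?thesis by (simp add: mult_ac)
    qed
    ultimately show "\<exists>z. ((\<lambda>x. s * x - arctan (s * tan x)) has_real_derivative z) (at y) \<and> 0 \<le> z"
      by fastforce
  qed
  thus ?thesis by simp
qed

lemma edge_length_bounds:
  "geodesic_polygon P \<Longrightarrow> 0 < edge_length P i" "geodesic_polygon P \<Longrightarrow> edge_length P i < pi"
  using spherical_edge_dist geodesic_polygon_edge by (auto simp: edge_length_def)

lemma sbigs_new_length_bounds:
  assumes "geodesic_polygon P"
  shows "0 < sbigs_new_length P i" "sbigs_new_length P i < pi / 2"
    "sbigs_new_length P i \<le> sqrt 2 / 2 * edge_length P i"
proof -
  let ?c = "cos (sbigs_base_angle P i)" and ?l = "edge_length P i"
  have c: "sqrt 2 / 2 \<le> ?c" "0 < ?c" "?c \<le> 1"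
    using cos_sbigs_base_angle[of P i] by (auto intro: less_le_trans[of 0 "sqrt 2 / 2"])
  have l: "0 < ?l" "?l < pi" using edge_length_bounds[OF assms] by auto
  have "0 < tan (?l / 2)" using l by (intro tan_gt_zero) auto
  thus "0 < sbigs_new_length P i" using c by (simp add: sbigs_new_length_def)
  show "sbigs_new_length P i < pi / 2" unfolding sbigs_new_length_def by (rule arctan_ubound)
  have "sbigs_new_length P i \<le> (1 / ?c) * (?l / 2)"
    using arctan_mult_tan_le[of "1 / ?c" "?l / 2"] c l by (simp add: sbigs_new_length_def)
  also have "\<dots> \<le> sqrt 2 * (?l / 2)"
  proof (rule mult_right_mono)
    have "1 = sqrt 2 * (sqrt 2 / 2)" by simp
    also have "\<dots> \<le> sqrt 2 * ?c" using c by (intro mult_left_mono) auto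
    finally show "1 / ?c \<le> sqrt 2" using c by (simp add: field_simps)
  qed (use l in simp)
  finally show "sbigs_new_length P i \<le> sqrt 2 / 2 * ?l" by simp
qed

text \<open>The right triangle relation \<open>tan e cos \<alpha> = tan (l / 2)\<close> cleared of denominators. It says that the
  two isosceles triangle sides, drawn from the two ends of the edge, meet.\<close>

lemma sbigs_new_length_eq:
  assumes "geodesic_polygon P"
  shows "cos (sbigs_new_length P i) * sin (edge_length P i) =
    sin (sbigs_new_length P i) * cos (sbigs_base_angle P i) * (1 + cos (edge_length P i))"
proof -
  let ?c = "cos (sbigs_base_angle P i)" and ?l = "edge_length P i" and ?e = "sbigs_new_length P i"
  have c: "0 < ?c"
    using cos_sbigs_base_angle[of P i] by (auto intro: less_le_trans[of 0 "sqrt 2 / 2"])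
  have e: "0 < cos ?e" using sbigs_new_length_bounds[OF assms, of i] by (intro cos_gt_zero_pi) auto
  have "- 1 < cos ?l" using edge_length_bounds[OF assms, of i] cos_monotone_0_pi[of ?l pi] by simp
  moreover have "tan ?e * ?c = tan (?l / 2)" using c by (simp add: sbigs_new_length_def tan_arctan)
  moreover have "tan (?l / 2) = sin ?l / (1 + cos ?l)"
    using tan_half[of "?l / 2"] by (simp add: add.commute)
  moreover have "tan ?e = sin ?e / cos ?e" by (simp add: tan_def)
  ultimately have "(sin ?e * ?c) / cos ?e = sin ?l / (1 + cos ?l)" "1 + cos ?l \<noteq> 0" by simp_all
  thus ?thesis using e by (subst (asm) frac_eq_eq) (auto simp: mult.commute)
qed

lemma sbigs_new_point_from_left:
  assumes "geodesic_polygon P"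
  shows "sbigs_new_point P i = cos (sbigs_new_length P i) *\<^sub>R P i
    + sin (sbigs_new_length P i) *\<^sub>R rotation (P i) (sbigs_base_angle P i) (outgoing_dir P i)"
proof -
  note o = outgoing_incoming_dir[OF assms, of i]
  define w where "w = rotation (P i) (sbigs_base_angle P i) (outgoing_dir P i)"
  have w: "norm w = 1" "P i \<bullet> w = 0"
    using o norm_rotation_tangent rotation_tangent_orthogonal by (auto simp: w_def)
  have "(norm (cross3 (P i) w))\<^sup>2 = 1" using norm_cross_dot[of "P i" w] w o by simp
  hence n: "norm (cross3 (P i) w) = 1"
    by (metis norm_ge_zero one_power2 power2_eq_imp_eq zero_le_one)
  have "cross3 (P i) w \<bullet> P i = 0" by (simp add: dot_cross_self)
  from rotation_tangent[OF n this] show ?thesis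
    unfolding sbigs_new_point_def Let_def w_def[symmetric]
    using cross3_unit_tangent(2)[OF o(1) w(2)] by simp
qed

text \<open>The scheme constructs the new vertex from the left end of the edge. The same vertex arises from
  the right end with the opposite base angle: both expressions have the component \<open>sin e sin \<alpha>\<close> along
  the common normal \<open>N\<close> of the edge, and \<open>sbigs_new_length_eq\<close> matches the components in its plane.\<close>

lemma sbigs_new_point_from_right:
  assumes "geodesic_polygon P"
  shows "sbigs_new_point P i = cos (sbigs_new_length P i) *\<^sub>R P (i + 1)
    + sin (sbigs_new_length P i) *\<^sub>R
      rotation (P (i + 1)) (- sbigs_base_angle P i) (- incoming_dir P (i + 1))"
proof -
  define l e a where "l = edge_length P i" and "e = sbigs_new_length P i" and "a = sbigs_base_angle P i"
  define p q where "p = P i" and "q = P (i + 1)"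
  have E: "spherical_edge p q" "spherical_edge q p"
    using geodesic_polygon_edge[OF assms, of i] spherical_edge_commute by (auto simp: p_def q_def)
  have ld: "l = geodesic_dist p q" "l = geodesic_dist q p"
    by (simp_all add: l_def p_def q_def edge_length_def geodesic_dist_commute)
  have s: "sin l > 0" using spherical_edge_dist[OF E(1)] ld by simp
  define N where "N = (1 / sin l) *\<^sub>R cross3 p q"
  have U: "start_dir p q = (1 / sin l) *\<^sub>R (q - cos l *\<^sub>R p)"
    and V: "start_dir q p = (1 / sin l) *\<^sub>R (p - cos l *\<^sub>R q)"
    by (simp_all add: start_dir_def ld(1) geodesic_dist_commute)
  have "cross3 p (start_dir p q) = N"
    by (simp add: U N_def cross_mult_right Cross3.right_diff_distrib scaleR_diff_right)
  moreover have "cross3 q (start_dir q p) = - N"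
    using cross_skew[of q p]
    by (simp add: V N_def cross_mult_right Cross3.right_diff_distrib scaleR_diff_right)
  ultimately have R: "rotation p a (start_dir p q) = cos a *\<^sub>R start_dir p q + sin a *\<^sub>R N"
      "rotation q (- a) (start_dir q p) = cos a *\<^sub>R start_dir q p + sin a *\<^sub>R N"
    using start_dir[OF E(1)] start_dir[OF E(2)] E
    by (simp_all add: rotation_tangent spherical_edge_def)
  have eq: "cos e * sin l = sin e * cos a * (1 + cos l)"
    using sbigs_new_length_eq[OF assms, of i] by (simp add: e_def l_def a_def)
  have k: "cos e = sin e * cos a * (1 / sin l) + sin e * cos a * (1 / sin l) * cos l"
    using eq s by (simp add: field_simps)
  have "cos e *\<^sub>R p + sin e *\<^sub>R rotation p a (start_dir p q)
      = cos e *\<^sub>R q + sin e *\<^sub>R rotation q (- a) (start_dir q p)"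
    unfolding R unfolding U V by (subst (1 2) k) (simp add: algebra_simps)
  thus ?thesis
    unfolding sbigs_new_point_from_left[OF assms] outgoing_dir_eq[OF assms] incoming_dir_eq[OF assms]
    by (simp add: p_def q_def e_def a_def)
qed

lemma sbigs_step_even [simp]: "sbigs_step P (2 * i) = P i"
  and sbigs_step_odd [simp]: "sbigs_step P (2 * i + 1) = sbigs_new_point P i"
  by (simp_all add: sbigs_step_def)

lemma even_odd_cases_int:
  obtains i where "k = 2 * i" | i where "k = 2 * i + (1 :: int)"
  by (metis evenE oddE)

lemma sbigs_edge_from_left:
  assumes "geodesic_polygon P"
  shows "spherical_edge (P i) (sbigs_new_point P i)"
    "geodesic_dist (P i) (sbigs_new_point P i) = sbigs_new_length P i"
    "start_dir (P i) (sbigs_new_point P i) = rotation (P i) (sbigs_base_angle P i) (outgoing_dir P i)"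
  using geodesic_polar[OF _ _ _ _ _ sbigs_new_point_from_left[OF assms]]
    outgoing_incoming_dir[OF assms, of i] sbigs_new_length_bounds[OF assms, of i]
    norm_rotation_tangent rotation_tangent_orthogonal by auto

lemma sbigs_edge_from_right:
  assumes "geodesic_polygon P"
  shows "spherical_edge (P (i + 1)) (sbigs_new_point P i)"
    "geodesic_dist (P (i + 1)) (sbigs_new_point P i) = sbigs_new_length P i"
    "start_dir (P (i + 1)) (sbigs_new_point P i) =
      - rotation (P (i + 1)) (- sbigs_base_angle P i) (incoming_dir P (i + 1))"
  using geodesic_polar[OF _ _ _ _ _ sbigs_new_point_from_right[OF assms]]
    outgoing_incoming_dir[OF assms, of "i + 1"] sbigs_new_length_bounds[OF assms, of i]
    norm_rotation_tangent rotation_tangent_orthogonal by (auto simp: rotation_minus_tangent)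

lemma geodesic_polygon_sbigs_step:
  assumes "geodesic_polygon P"
  shows "geodesic_polygon (sbigs_step P)"
proof -
  have "spherical_edge (sbigs_step P k) (sbigs_step P (k + 1))" for k
  proof (cases k rule: even_odd_cases_int)
    case (1 i)
    thus ?thesis using sbigs_edge_from_left[OF assms, of i] by simp
  next
    case (2 i)
    moreover have "sbigs_step P (2 * i + 1 + 1) = P (i + 1)"
      using sbigs_step_even[of P "i + 1"] by (simp add: algebra_simps)
    ultimately show ?thesis
      using sbigs_edge_from_right[OF assms, of i] spherical_edge_commute by simp
  qed
  thus ?thesis by (auto simp: geodesic_polygon_def spherical_edge_def)
qed

lemma edge_length_sbigs_step:
  assumes "geodesic_polygon P"
  shows "edge_length (sbigs_step P) k = sbigs_new_length P (k div 2)"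
proof (cases k rule: even_odd_cases_int)
  case (1 i)
  thus ?thesis using sbigs_edge_from_left[OF assms, of i] by (simp add: edge_length_def)
next
  case (2 i)
  moreover have "sbigs_step P (2 * i + 1 + 1) = P (i + 1)"
    using sbigs_step_even[of P "i + 1"] by (simp add: algebra_simps)
  ultimately show ?thesis
    using sbigs_edge_from_right[OF assms, of i] geodesic_dist_commute by (simp add: edge_length_def)
qed

lemma outgoing_dir_sbigs_step_even:
  assumes "geodesic_polygon P"
  shows "outgoing_dir (sbigs_step P) (2 * i) = rotation (P i) (sbigs_base_angle P i) (outgoing_dir P i)"
  using sbigs_edge_from_left(3)[OF assms, of i]
  by (simp add: outgoing_dir_eq[OF geodesic_polygon_sbigs_step[OF assms]])

lemma incoming_dir_sbigs_step_even:
  assumes "geodesic_polygon P"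
  shows "incoming_dir (sbigs_step P) (2 * i) =
    rotation (P i) (- sbigs_base_angle P (i - 1)) (incoming_dir P i)"
proof -
  have "sbigs_step P (2 * i - 1) = sbigs_new_point P (i - 1)"
    using sbigs_step_odd[of P "i - 1"] by (simp add: algebra_simps)
  thus ?thesis using sbigs_edge_from_right(3)[OF assms, of "i - 1"]
    by (simp add: incoming_dir_eq[OF geodesic_polygon_sbigs_step[OF assms]])
qed

text \<open>The outgoing direction turns by \<open>\<alpha>\<^bsub>i\<^esub>\<close> and the incoming one by \<open>-\<alpha>\<^bsub>i-1\<^esub>\<close>. The resulting angle is a
  combination of three defects in \<open>(-\<pi>, \<pi>]\<close> whose coefficients have absolute sum \<open>1\<close>, so it does not leave that interval.\<close>

lemma angular_defect_sbigs_step_even: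
  assumes "geodesic_polygon P"
  shows "angular_defect (sbigs_step P) (2 * i) =
    (6 * angular_defect P i - angular_defect P (i - 1) - angular_defect P (i + 1)) / 8"
proof -
  have b: "- pi < angular_defect P k" "angular_defect P k \<le> pi" for k
    using signed_angle_bounds by (simp_all add: angular_defect_def)
  have val: "angular_defect P i + (- sbigs_base_angle P (i - 1)) - sbigs_base_angle P i =
      (6 * angular_defect P i - angular_defect P (i - 1) - angular_defect P (i + 1)) / 8"
    by (simp add: sbigs_base_angle_def field_simps)
  have "angular_defect (sbigs_step P) (2 * i) =
      angular_defect P i + (- sbigs_base_angle P (i - 1)) - sbigs_base_angle P i"
    unfolding angular_defect_def[of "sbigs_step P"] sbigs_step_even
      outgoing_dir_sbigs_step_even[OF assms] incoming_dir_sbigs_step_even[OF assms]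
    unfolding angular_defect_def[of P i]
  proof (rule signed_angle_rotation_rotation)
    show "- pi < signed_angle (P i) (outgoing_dir P i) (incoming_dir P i) + - sbigs_base_angle P (i - 1) - sbigs_base_angle P i"
      "signed_angle (P i) (outgoing_dir P i) (incoming_dir P i) + - sbigs_base_angle P (i - 1) - sbigs_base_angle P i \<le> pi"
      unfolding angular_defect_def[symmetric] val
      using b[of i] b[of "i - 1"] b[of "i + 1"] by auto
  qed (use outgoing_incoming_dir[OF assms] in auto)
  thus ?thesis unfolding val .
qed

text \<open>The exterior angle at the apex of a planar isosceles triangle is twice the base angle. On the
  sphere the angle sum exceeds \<open>\<pi>\<close>, so the exterior angle is smaller in modulus. The proof compares
  cosines: the one of the exterior angle is \<open>(cos\<^sup>2 e - cos l) / sin\<^sup>2 e\<close>, and in terms of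
  \<open>S = sin\<^sup>2 e\<close>, \<open>C = cos\<^sup>2 \<alpha>\<close>, \<open>k = cos l\<close> its excess over \<open>cos 2\<alpha>\<close>, multiplied by \<open>S\<close>,
  factors as \<open>S (1 - k) (1 - C) \<ge> 0\<close>.\<close>

lemma angular_defect_sbigs_step_odd:
  assumes "geodesic_polygon P"
  shows "\<bar>angular_defect (sbigs_step P) (2 * i + 1)\<bar> \<le> 2 * \<bar>sbigs_base_angle P i\<bar>"
proof -
  let ?Q = "sbigs_step P" and ?k = "2 * i + 1"
  note G = geodesic_polygon_sbigs_step[OF assms]
  define l e a where "l = edge_length P i" and "e = sbigs_new_length P i" and "a = sbigs_base_angle P i"
  define p q r where "p = P i" and "q = sbigs_new_point P i" and "r = P (i + 1)"
  have Q: "?Q ?k = q" "?Q (?k - 1) = p" "?Q (?k + 1) = r"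
    using sbigs_step_even[of P "i + 1"] by (simp_all add: p_def q_def r_def distrib_left add.assoc)
  have dist: "geodesic_dist q p = e" "geodesic_dist q r = e"
    using sbigs_edge_from_left[OF assms, of i] sbigs_edge_from_right[OF assms, of i]
    by (simp_all add: p_def q_def r_def e_def geodesic_dist_commute)
  have E: "spherical_edge q p" "spherical_edge q r" "spherical_edge p r"
    using sbigs_edge_from_left[OF assms, of i] sbigs_edge_from_right[OF assms, of i]
      geodesic_polygon_edge[OF assms, of i] spherical_edge_commute
    by (simp_all add: p_def q_def r_def)
  have dots: "q \<bullet> q = 1" "q \<bullet> p = cos e" "q \<bullet> r = cos e" "p \<bullet> r = cos l"
    using spherical_edge_dist(3)[OF E(1)] spherical_edge_dist(3)[OF E(2)] spherical_edge_dist(3)[OF E(3)] dist E(1)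
    by (simp_all add: spherical_edge_def norm_eq_1 l_def edge_length_def p_def r_def)
  have se: "sin e > 0" using spherical_edge_dist(4)[OF E(1)] dist by simp
  have k1: "cos l < 1"
    using spherical_edge_dist(1,2)[OF E(3)] cos_monotone_0_pi[of 0 l]
    by (simp add: l_def edge_length_def p_def r_def)
  have "outgoing_dir ?Q ?k \<bullet> incoming_dir ?Q ?k = - (start_dir q r \<bullet> start_dir q p)"
    by (simp only: outgoing_dir_eq[OF G] incoming_dir_eq[OF G] Q inner_minus_right)
  also have "\<dots> = ((cos e)\<^sup>2 - cos l) / (sin e)\<^sup>2"
    using dots by (simp add: start_dir_def dist inner_diff inner_commute power2_eq_square diff_divide_distrib)
  also have "\<dots> \<ge> cos (2 * a)"
  proof -
    define S C k where "S = (sin e)\<^sup>2" and "C = (cos a)\<^sup>2" and "k = cos l"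
    have S: "S > 0" using se by (simp add: S_def)
    have C: "C \<le> 1" by (simp add: C_def abs_square_le_1)
    have "(cos e * sin l)\<^sup>2 = (sin e * cos a * (1 + cos l))\<^sup>2"
      using sbigs_new_length_eq[OF assms, of i] by (simp add: e_def l_def a_def)
    moreover have ce: "(cos e)\<^sup>2 = 1 - S" and "(sin l)\<^sup>2 = 1 - k\<^sup>2"
      unfolding S_def k_def by (rule cos_squared_eq, rule sin_squared_eq)
    ultimately have "(1 - S) * (1 - k\<^sup>2) = S * C * (1 + k)\<^sup>2"
      by (simp only: power_mult_distrib S_def[symmetric] C_def[symmetric] k_def[symmetric])
    hence "(1 + k) * ((1 - S) * (1 - k)) = (1 + k) * (S * C * (1 + k))"
      by (simp add: power2_eq_square algebra_simps)
    moreover have "0 < 1 + k"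
      using spherical_edge_dist(1,2)[OF E(3)] cos_monotone_0_pi[of l pi]
      by (simp add: k_def l_def edge_length_def p_def r_def)
    ultimately have "(1 - S) * (1 - k) = S * C * (1 + k)" by simp
    hence "(1 - S - k) - (2 * C - 1) * S = S * ((1 - k) * (1 - C))"
      by (simp add: algebra_simps)
    also have "\<dots> \<ge> 0" using S C k1 by (intro mult_nonneg_nonneg) (auto simp: k_def)
    finally have "(2 * C - 1) * S \<le> 1 - S - k" by simp
    thus ?thesis
      using S unfolding cos_double_cos ce S_def[symmetric] C_def[symmetric] k_def[symmetric]
      by (simp add: pos_le_divide_eq)
  qed
  also have "outgoing_dir ?Q ?k \<bullet> incoming_dir ?Q ?k = cos \<bar>angular_defect ?Q ?k\<bar>"
    unfolding angular_defect_def
    using cos_signed_angle outgoing_incoming_dir[OF G, of ?k] by simp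
  finally have "cos (2 * \<bar>a\<bar>) \<le> cos \<bar>angular_defect ?Q ?k\<bar>"
    using cos_abs_real[of "2 * a"] by (simp add: abs_mult)
  thus ?thesis
    using sbigs_base_angle_bound[of P i] angular_defect_bound[of ?Q ?k]
    by (subst (asm) cos_mono_le_eq) (auto simp: a_def)
qed

section \<open>Geometric decay of edges and defects\<close>

lemma sbigs_Suc: "sbigs P0 (Suc j) = sbigs_step (sbigs P0 j)"
  by (simp add: sbigs_def)

lemma geodesic_polygon_sbigs:
  "geodesic_polygon P0 \<Longrightarrow> geodesic_polygon (sbigs P0 j)"
  by (induction j) (simp_all add: sbigs_Suc geodesic_polygon_sbigs_step, simp add: sbigs_def)

text \<open>One step contracts the edges by \<open>sqrt 2 / 2\<close>. With the larger ratio \<open>11 / 12\<close> edges and defects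
  share one rate.\<close>

lemma sbigs_edge_length_decay:
  assumes "geodesic_polygon P0"
  shows "edge_length (sbigs P0 j) k \<le> 4 * (11 / 12) ^ j"
proof (induction j arbitrary: k)
  case 0
  show ?case
    using edge_length_bounds(2)[OF assms, of k] pi_less_4 by (simp add: sbigs_def)
next
  case (Suc j)
  note G = geodesic_polygon_sbigs[OF assms, of j]
  let ?l = "edge_length (sbigs P0 j) (k div 2)"
  have "sqrt 2 \<le> 11 / (6 :: real)" by (rule real_le_lsqrt) (simp_all add: power2_eq_square)
  hence "sqrt 2 / 2 \<le> 11 / (12 :: real)" by simp
  hence "sqrt 2 / 2 * ?l \<le> 11 / 12 * (4 * (11 / 12) ^ j)"
    using Suc[of "k div 2"] edge_length_bounds(1)[OF G, of "k div 2"] by (intro mult_mono) auto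
  thus ?case
    using sbigs_new_length_bounds(3)[OF G, of "k div 2"]
    by (simp add: sbigs_Suc edge_length_sbigs_step[OF G])
qed

text \<open>The bound for odd vertices is an invariant. Of two neighbours one is odd, so the base angle formula
  gives \<open>(1 + 2/3) / 4 = 5 / 12\<close> at new vertices, which is below \<open>2/3 \<cdot> 11/12\<close>. At an old even vertex both
  neighbours are odd, which gives \<open>(2/3 + 6 + 2/3) / 8 = 11 / 12\<close>; at an old odd vertex one gets
  \<open>(1 + 6 \<cdot> 2/3 + 1) / 8 = 3 / 4\<close>. The factor \<open>5\<close> makes the initial odd bound \<open>10/3\<close> exceed \<open>\<pi>\<close>.\<close>

lemma sbigs_angular_defect_decay:
  assumes "geodesic_polygon P0"
  shows "\<bar>angular_defect (sbigs P0 j) k\<bar> \<le> 5 * (11 / 12) ^ j \<and>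
    (odd k \<longrightarrow> \<bar>angular_defect (sbigs P0 j) k\<bar> \<le> 2 / 3 * (5 * (11 / 12) ^ j))"
proof (induction j arbitrary: k)
  case 0
  have "pi \<le> 2 / 3 * 5" using pi_approx by simp
  then show ?case using angular_defect_bound[of "sbigs P0 0" k] by simp
next
  case (Suc j)
  let ?P = "sbigs P0 j"
  let ?d = "angular_defect ?P" and ?D = "5 * (11 / 12 :: real) ^ j"
  note G = geodesic_polygon_sbigs[OF assms, of j]
  have all: "\<bar>?d i\<bar> \<le> ?D" and odds: "odd i \<Longrightarrow> \<bar>?d i\<bar> \<le> 2 / 3 * ?D" for i
    using Suc by blast+
  have D: "?D \<ge> 0" by simp
  have odd_case: "\<bar>angular_defect (sbigs_step ?P) (2 * i + 1)\<bar> \<le> 5 / 12 * ?D" for i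
  proof -
    have "\<bar>?d i + ?d (i + 1)\<bar> \<le> 5 / 3 * ?D"
    proof (cases "odd i")
      case True
      thus ?thesis using odds[of i] all[of "i + 1"] by linarith
    next
      case False
      hence "odd (i + 1)" by simp
      thus ?thesis using odds[of "i + 1"] all[of i] by linarith
    qed
    thus ?thesis
      using angular_defect_sbigs_step_odd[OF G, of i] by (simp add: sbigs_base_angle_def)
  qed
  have even_case: "\<bar>angular_defect (sbigs_step ?P) (2 * i)\<bar> \<le> 11 / 12 * ?D" for i
  proof -
    have "\<bar>6 * ?d i - ?d (i - 1) - ?d (i + 1)\<bar> \<le> 22 / 3 * ?D"
    proof (cases "odd i")
      case True
      then show ?thesis using odds[of i] all[of "i - 1"] all[of "i + 1"] D by linarith
    next
      case False
      hence "odd (i - 1)" "odd (i + 1)" by simp_all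
      then show ?thesis using all[of i] odds[of "i - 1"] odds[of "i + 1"] by linarith
    qed
    thus ?thesis unfolding angular_defect_sbigs_step_even[OF G] by simp
  qed
  have "\<bar>angular_defect (sbigs P0 (Suc j)) k\<bar> \<le> 5 * (11 / 12) ^ Suc j"
  proof (cases k rule: even_odd_cases_int)
    case (1 i)
    thus ?thesis using even_case[of i] by (simp add: sbigs_Suc)
  next
    case (2 i)
    thus ?thesis using odd_case[of i] D by (simp add: sbigs_Suc)
  qed
  moreover have "\<bar>angular_defect (sbigs P0 (Suc j)) k\<bar> \<le> 2 / 3 * (5 * (11 / 12) ^ Suc j)" if "odd k"
  proof -
    obtain i where "k = 2 * i + 1" using \<open>odd k\<close> by (elim oddE)
    thus ?thesis using odd_case[of i] D by (simp add: sbigs_Suc)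
  qed
  ultimately show ?case by blast
qed

section \<open>Variation of the edge directions\<close>

lemma outgoing_dir_jump:
  assumes "geodesic_polygon P"
  shows "norm (outgoing_dir P (k + 1) - outgoing_dir P k) \<le> \<bar>angular_defect P (k + 1)\<bar> + edge_length P k"
proof -
  note o = outgoing_incoming_dir[OF assms, of "k + 1"]
  have "norm (outgoing_dir P (k + 1) - incoming_dir P (k + 1)) \<le> \<bar>angular_defect P (k + 1)\<bar>"
    using o cos_signed_angle[OF o] by (intro norm_diff_le_angle) (simp_all add: angular_defect_def)
  moreover have "norm (incoming_dir P (k + 1) - outgoing_dir P k) \<le> edge_length P k"
    using end_velocity_near_start_dir[OF geodesic_polygon_edge[OF assms, of k]]
    by (simp add: incoming_dir_eq[OF assms] outgoing_dir_eq[OF assms] edge_length_def)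
  ultimately show ?thesis
    using norm_triangle_ineq[of "outgoing_dir P (k + 1) - incoming_dir P (k + 1)"
      "incoming_dir P (k + 1) - outgoing_dir P k"] by simp
qed

text \<open>The first half of a subdivided edge starts at the old vertex, where its direction is the old one
  rotated by the base angle. The second half is reached from the first by one jump of the new polygon.\<close>

lemma outgoing_dir_refine:
  assumes "geodesic_polygon P"
  shows "norm (outgoing_dir (sbigs_step P) k - outgoing_dir P (k div 2)) \<le>
    \<bar>sbigs_base_angle P (k div 2)\<bar> + \<bar>angular_defect (sbigs_step P) k\<bar> + edge_length (sbigs_step P) (k - 1)"
proof -
  note G = geodesic_polygon_sbigs_step[OF assms]
  have even_case: "norm (outgoing_dir (sbigs_step P) (2 * i) - outgoing_dir P i) \<le> \<bar>sbigs_base_angle P i\<bar>" for i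
  proof -
    note o = outgoing_incoming_dir[OF assms, of i]
    show ?thesis
      unfolding outgoing_dir_sbigs_step_even[OF assms]
      using o norm_rotation_tangent[OF o(1,2,4)] rotation_tangent_inner[OF o(1,2,4)]
      by (intro norm_diff_le_angle) (simp_all add: inner_commute)
  qed
  show ?thesis
  proof (cases k rule: even_odd_cases_int)
    case (1 i)
    thus ?thesis
      using even_case[of i] edge_length_bounds(1)[OF G, of "k - 1"] by simp
  next
    case (2 i)
    have "norm (outgoing_dir (sbigs_step P) (2 * i + 1) - outgoing_dir P i) \<le>
        norm (outgoing_dir (sbigs_step P) (2 * i + 1) - outgoing_dir (sbigs_step P) (2 * i))
        + norm (outgoing_dir (sbigs_step P) (2 * i) - outgoing_dir P i)"
      using norm_triangle_ineq[of "outgoing_dir (sbigs_step P) (2 * i + 1) - outgoing_dir (sbigs_step P) (2 * i)"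
        "outgoing_dir (sbigs_step P) (2 * i) - outgoing_dir P i"] by simp
    thus ?thesis
      using 2 even_case[of i] outgoing_dir_jump[OF G, of "2 * i"] by simp
  qed
qed

section \<open>Limits of dyadic step functions\<close>

text \<open>The step functions \<open>t \<mapsto> x j \<lfloor>2\<^sup>j t\<rfloor>\<close> form a uniform Cauchy sequence by \<open>refine\<close>. Their limit is
  continuous although they are not, since their jumps tend to \<open>0\<close> and parameters closer than \<open>1 / 2\<^sup>j\<close>
  lie on the same or on neighbouring steps.\<close>

lemma dyadic_steps_converge:
  fixes x :: "nat \<Rightarrow> int \<Rightarrow> 'a :: banach" and K r :: real
  assumes r: "0 \<le> r" "r < 1"
    and refine: "\<And>j k. norm (x (Suc j) k - x j (k div 2)) \<le> K * r ^ j"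
    and jump: "\<And>j k. norm (x j (k + 1) - x j k) \<le> K * r ^ j"
  obtains f :: "real \<Rightarrow> 'a" where "continuous_on UNIV f"
    "\<And>j t. norm (x j \<lfloor>2 ^ j * t\<rfloor> - f t) \<le> K / (1 - r) * r ^ j"
proof -
  define F where "F j t = x j \<lfloor>2 ^ j * t\<rfloor>" for j and t :: real
  define B where "B = K / (1 - r)"
  have "B * (1 - r) = K" using r by (simp add: B_def)
  hence K: "K = B - B * r" by (simp add: algebra_simps)
  have "0 \<le> K" using order_trans[OF norm_ge_zero jump[of 0 0]] by simp
  hence B0: "0 \<le> B" using r by (simp add: B_def)
  have step: "norm (F (Suc j) t - F j t) \<le> K * r ^ j" for j t
  proof -
    have "\<lfloor>2 ^ Suc j * t\<rfloor> div 2 = \<lfloor>2 ^ j * t\<rfloor>"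
      using floor_divide_real_eq_div[of 2 "2 ^ Suc j * t"] by simp
    thus ?thesis using refine[of j "\<lfloor>2 ^ Suc j * t\<rfloor>"] by (simp add: F_def)
  qed
  have tele: "norm (F (j + n) t - F j t) \<le> B * r ^ j - B * r ^ (j + n)" for j n t
  proof (induction n)
    case (Suc n)
    have "F (j + Suc n) t - F j t = (F (Suc (j + n)) t - F (j + n) t) + (F (j + n) t - F j t)" by simp
    also have "norm \<dots> \<le> K * r ^ (j + n) + (B * r ^ j - B * r ^ (j + n))"
      using step Suc by (intro norm_triangle_mono)
    also have "\<dots> = B * r ^ j - B * r ^ (j + Suc n)" by (simp add: K algebra_simps)
    finally show ?case .
  qed simp
  have tele': "norm (F (j + n) t - F j t) \<le> B * r ^ j" for j n t
    using tele[of j n t] B0 r by (smt (verit) mult_nonneg_nonneg zero_le_power)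
  have zero: "(\<lambda>j. C * r ^ j) \<longlonglongrightarrow> 0" for C
    using r by (intro tendsto_mult_right_zero LIMSEQ_power_zero) simp
  have "Cauchy (\<lambda>j. F j t)" for t
  proof (rule CauchyI')
    fix e :: real assume "0 < e"
    then obtain M where M: "\<And>j. j \<ge> M \<Longrightarrow> B * r ^ j < e"
      using order_tendstoD(2)[OF zero] unfolding eventually_sequentially by blast
    have "dist (F m t) (F n t) < e" if "m \<ge> M" "n > m" for m n
      using le_less_trans[OF tele'[of m "n - m" t] M[OF that(1)]] that by (simp add: dist_norm norm_minus_commute)
    thus "\<exists>M. \<forall>m\<ge>M. \<forall>n>m. dist (F m t) (F n t) < e" by blast
  qed
  then obtain f where f: "\<And>t. (\<lambda>j. F j t) \<longlonglongrightarrow> f t"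
    unfolding Cauchy_convergent_iff convergent_def by metis
  have bound: "norm (F j t - f t) \<le> B * r ^ j" for j t
  proof (rule Lim_norm_ubound[of sequentially])
    show "(\<lambda>n. F j t - F (n + j) t) \<longlonglongrightarrow> F j t - f t"
      by (intro tendsto_diff tendsto_const LIMSEQ_ignore_initial_segment f)
    show "\<forall>\<^sub>F n in sequentially. norm (F j t - F (n + j) t) \<le> B * r ^ j"
      using tele'[of j _ t] by (simp add: norm_minus_commute add.commute[of _ j])
  qed simp
  have "isCont f t" for t
    unfolding continuous_at_eps_delta
  proof (intro allI impI)
    fix e :: real assume "0 < e"
    then obtain j where j: "(2 * B + K) * r ^ j < e"
      using order_tendstoD(2)[OF zero] unfolding eventually_sequentially by blast
    have "dist (f s) (f t) < e" if s: "dist s t < 1 / 2 ^ j" for s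
    proof -
      have "\<bar>2 ^ j * s - 2 ^ j * t\<bar> < 1"
        using s by (simp add: dist_real_def abs_mult flip: right_diff_distrib) (simp add: field_simps)
      hence "\<lfloor>2 ^ j * s\<rfloor> = \<lfloor>2 ^ j * t\<rfloor> \<or> \<lfloor>2 ^ j * s\<rfloor> = \<lfloor>2 ^ j * t\<rfloor> + 1 \<or> \<lfloor>2 ^ j * t\<rfloor> = \<lfloor>2 ^ j * s\<rfloor> + 1"
        by linarith
      hence "norm (F j s - F j t) \<le> K * r ^ j"
        using jump[of j] \<open>0 \<le> K\<close> r unfolding F_def by (auto simp: norm_minus_commute)
      moreover have "f s - f t = (F j s - F j t) + ((F j t - f t) - (F j s - f s))" by simp
      ultimately have "norm (f s - f t) \<le> K * r ^ j + (B * r ^ j + B * r ^ j)"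
        using bound by (metis norm_triangle_mono norm_triangle_le_diff add_mono)
      thus ?thesis using j by (simp add: dist_norm algebra_simps)
    qed
    thus "\<exists>d>0. \<forall>s. dist s t < d \<longrightarrow> dist (f s) (f t) < e"
      by (intro exI[of _ "1 / 2 ^ j"]) simp
  qed
  hence "continuous_on UNIV f" by (simp add: continuous_at_imp_continuous_on)
  thus ?thesis using that[of f] bound unfolding F_def B_def by blast
qed

section \<open>Tangent directions as limits of chord directions\<close>

text \<open>Closeness of directions as membership in the cone \<open>{v. m * norm v \<le> v \<bullet> T}\<close>, which for
  \<open>m \<ge> 0\<close> is closed under addition and limits.\<close>

lemma norm_sgn_diff_le_iff:
  fixes v T :: "'a :: real_inner"
  assumes "norm T = 1" "v \<noteq> 0" "0 \<le> e"
  shows "norm (sgn v - T) \<le> e \<longleftrightarrow> (1 - e\<^sup>2 / 2) * norm v \<le> v \<bullet> T"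
proof -
  have "(norm (sgn v - T))\<^sup>2 = 2 - 2 * (v \<bullet> T / norm v)"
    using assms by (simp add: power2_norm_eq_inner inner_diff inner_commute norm_sgn sgn_div_norm norm_eq_1[symmetric])
      (simp add: norm_eq_1 power2_norm_eq_inner[symmetric] power2_eq_square field_simps)
  moreover have "norm (sgn v - T) \<le> e \<longleftrightarrow> (norm (sgn v - T))\<^sup>2 \<le> e\<^sup>2"
    using assms(3) by (simp add: power2_le_iff_abs_le)
  moreover have "2 - 2 * (v \<bullet> T / norm v) \<le> e\<^sup>2 \<longleftrightarrow> 1 - e\<^sup>2 / 2 \<le> v \<bullet> T / norm v" by linarith
  ultimately show ?thesis using assms(2) by (simp add: pos_le_divide_eq)
qed

text \<open>The cone argument. Edges near \<open>t\<close> lie in a narrow cone around \<open>T t\<close>, hence so do the vectors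
  between any two vertices near \<open>t\<close> (\<open>path\<close>) and, in the limit, all secants of \<open>c\<close> near \<open>t\<close> (\<open>cone\<close>).\<close>

lemma dyadic_tangent_direction:
  fixes x :: "nat \<Rightarrow> int \<Rightarrow> real^3" and c T :: "real \<Rightarrow> real^3"
  assumes nested: "\<And>j k. x (Suc j) (2 * k) = x j k"
    and distinct: "\<And>j k. x j (k + 1) \<noteq> x j k"
    and lim: "\<And>t. (\<lambda>j. x j \<lfloor>2 ^ j * t\<rfloor>) \<longlonglongrightarrow> c t"
    and dir: "uniform_limit UNIV (\<lambda>j t. sgn (x j (\<lfloor>2 ^ j * t\<rfloor> + 1) - x j \<lfloor>2 ^ j * t\<rfloor>)) T sequentially"
    and cont: "continuous_on UNIV T"
    and unit: "norm (T t) = 1"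
  shows "has_tangent_direction c (T t) t"
proof -
  have nested_pow: "x (j + n) (2 ^ n * k) = x j k" for j n k
    by (induction n) (simp_all add: nested mult.assoc)
  \<comment> \<open>Vertices persist, so the limit curve interpolates every polygon.\<close>
  have dyadic: "c (k / 2 ^ j) = x j k" for j k
  proof (rule LIMSEQ_unique[OF LIMSEQ_ignore_initial_segment[OF lim, where k = j]])
    have "\<lfloor>2 ^ (n + j) * (real_of_int k / 2 ^ j)\<rfloor> = 2 ^ n * k" for n
    proof -
      have "2 ^ (n + j) * (real_of_int k / 2 ^ j) = of_int (2 ^ n * k)" by (simp add: power_add)
      thus ?thesis by (simp only: floor_of_int)
    qed
    hence "(\<lambda>n. x (n + j) \<lfloor>2 ^ (n + j) * (real_of_int k / 2 ^ j)\<rfloor>) = (\<lambda>n. x j k)"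
      by (simp only: nested_pow add.commute[of _ j])
    thus "(\<lambda>n. x (n + j) \<lfloor>2 ^ (n + j) * (real_of_int k / 2 ^ j)\<rfloor>) \<longlonglongrightarrow> x j k"
      by (simp only: tendsto_const)
  qed
  have near: "\<exists>d>0. \<forall>a b. t - d < a \<and> a < b \<and> b < t + d \<longrightarrow> c b \<noteq> c a \<and> norm (sgn (c b - c a) - T t) \<le> e"
    if e: "0 < e" "e < 1" for e
  proof -
    define m where "m = 1 - e\<^sup>2 / 2"
    have "e\<^sup>2 < 1" using e by (simp add: power_less_one_iff)
    hence m: "m > 0" by (simp add: m_def)
    have "isCont T t" using cont by (simp add: continuous_on_eq_continuous_at)
    then obtain d where d: "d > 0" "\<And>s. \<bar>s - t\<bar> < d \<Longrightarrow> dist (T s) (T t) < e / 2"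
      using e unfolding continuous_at_eps_delta dist_real_def by (metis half_gt_zero)
    obtain N where N: "\<And>j s. j \<ge> N \<Longrightarrow>
        dist (sgn (x j (\<lfloor>2 ^ j * s\<rfloor> + 1) - x j \<lfloor>2 ^ j * s\<rfloor>)) (T s) < e / 2"
      using uniform_limitD[OF dir, of "e / 2"] e unfolding eventually_sequentially by auto
    have edge: "m * norm (x j (k + 1) - x j k) \<le> (x j (k + 1) - x j k) \<bullet> T t"
      if j: "j \<ge> N" and k: "\<bar>k / 2 ^ j - t\<bar> < d" for j k
    proof -
      have "2 ^ j * (k / 2 ^ j) = real_of_int k" by simp
      hence "dist (sgn (x j (k + 1) - x j k)) (T (k / 2 ^ j)) < e / 2"
        using N[OF j, of "k / 2 ^ j"] by simp
      with d(2)[OF k] have "dist (sgn (x j (k + 1) - x j k)) (T t) \<le> e"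
        using dist_triangle[of "sgn (x j (k + 1) - x j k)" "T t" "T (k / 2 ^ j)"] by simp
      thus ?thesis
        using norm_sgn_diff_le_iff[of "T t" "x j (k + 1) - x j k" e] distinct[of j k] unit e
        by (simp add: dist_norm m_def)
    qed
    have path: "m * norm (x j (k + int n) - x j k) \<le> (x j (k + int n) - x j k) \<bullet> T t"
      if j: "j \<ge> N" and k: "t - d < k / 2 ^ j" "(k + int n) / 2 ^ j < t + d" for j k n
      using k(2)
    proof (induction n)
      case (Suc n)
      let ?k = "k + int n"
      have le: "k / 2 ^ j \<le> ?k / 2 ^ j" "?k / 2 ^ j \<le> (k + int (Suc n)) / 2 ^ j"
        by (simp_all add: divide_right_mono)
      have "\<bar>?k / 2 ^ j - t\<bar> < d" using le k(1) Suc.prems by linarith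
      note E = edge[OF j this]
      have I: "m * norm (x j ?k - x j k) \<le> (x j ?k - x j k) \<bullet> T t"
        using le Suc by linarith
      have split: "x j (k + int (Suc n)) - x j k = (x j (?k + 1) - x j ?k) + (x j ?k - x j k)"
        by (simp add: ac_simps)
      have "m * norm (x j (k + int (Suc n)) - x j k) \<le> m * (norm (x j (?k + 1) - x j ?k) + norm (x j ?k - x j k))"
        unfolding split using m by (intro mult_left_mono norm_triangle_ineq) simp
      also have "\<dots> \<le> (x j (?k + 1) - x j ?k) \<bullet> T t + (x j ?k - x j k) \<bullet> T t"
        using E I by (simp add: distrib_left)
      finally show ?case unfolding split inner_add_left .
    qed simp
    have cone: "m * norm (c b - c a) \<le> (c b - c a) \<bullet> T t" if ab: "t - d < a" "a \<le> b" "b < t + d" for a b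
    proof (rule tendsto_le[OF sequentially_bot])
      let ?D = "\<lambda>j. x j \<lfloor>2 ^ j * b\<rfloor> - x j \<lfloor>2 ^ j * a\<rfloor>"
      show "(\<lambda>j. ?D j \<bullet> T t) \<longlonglongrightarrow> (c b - c a) \<bullet> T t" "(\<lambda>j. m * norm (?D j)) \<longlonglongrightarrow> m * norm (c b - c a)"
        by (intro tendsto_intros lim)+
      \<comment> \<open>The vertex with index \<open>\<lfloor>2 ^ j * a\<rfloor>\<close> may belong to a parameter below \<open>a\<close>, by less than \<open>1 / 2 ^ j\<close>.\<close>
      have "(\<lambda>j. a - (1 / 2) ^ j) \<longlonglongrightarrow> a - 0"
        by (intro tendsto_diff tendsto_const LIMSEQ_power_zero) simp
      hence "\<forall>\<^sub>F j in sequentially. t - d < a - (1 / 2) ^ j"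
        using ab(1) by (intro order_tendstoD(1)) auto
      then show "\<forall>\<^sub>F j in sequentially. m * norm (?D j) \<le> ?D j \<bullet> T t"
        using eventually_ge_at_top[of N]
      proof eventually_elim
        case (elim j)
        define n where "n = nat (\<lfloor>2 ^ j * b\<rfloor> - \<lfloor>2 ^ j * a\<rfloor>)"
        have "\<lfloor>2 ^ j * a\<rfloor> \<le> \<lfloor>2 ^ j * b\<rfloor>" using ab(2) by (intro floor_mono) simp
        hence n: "\<lfloor>2 ^ j * b\<rfloor> = \<lfloor>2 ^ j * a\<rfloor> + int n" by (simp add: n_def)
        have "2 ^ j * a - 1 < \<lfloor>2 ^ j * a\<rfloor>" by linarith
        hence "(2 ^ j * a - 1) / 2 ^ j < \<lfloor>2 ^ j * a\<rfloor> / 2 ^ j" by (intro divide_strict_right_mono) simp_all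
        hence A: "t - d < \<lfloor>2 ^ j * a\<rfloor> / 2 ^ j"
          using elim(1) by (simp add: diff_divide_distrib power_one_over)
        have "\<lfloor>2 ^ j * b\<rfloor> / 2 ^ j \<le> (2 ^ j * b) / 2 ^ j" by (intro divide_right_mono) simp_all
        hence "\<lfloor>2 ^ j * b\<rfloor> / 2 ^ j < t + d" using ab(3) by simp
        thus ?case using path[OF elim(2) A, of n] n by simp
      qed
    qed
    have "c b \<noteq> c a \<and> norm (sgn (c b - c a) - T t) \<le> e" if ab: "t - d < a" "a < b" "b < t + d" for a b
    proof -
      have lim0: "(\<lambda>j. 2 * (1 / 2 :: real) ^ j) \<longlonglongrightarrow> 0"
        by (intro tendsto_mult_right_zero LIMSEQ_power_zero) simp
      have "\<forall>\<^sub>F j in sequentially. 2 * (1 / 2 :: real) ^ j < b - a"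
        using ab(2) by (intro order_tendstoD(2)[OF lim0]) simp
      then obtain j where j: "2 * (1 / 2 :: real) ^ j < b - a"
        unfolding eventually_sequentially by blast
      \<comment> \<open>The edge number \<open>k\<close> of level \<open>j\<close> has its whole parameter interval inside \<open>(a, b)\<close>.\<close>
      define k where "k = \<lfloor>2 ^ j * a\<rfloor> + 1"
      have "2 ^ j * a < k" "k + 1 \<le> 2 ^ j * a + 2" unfolding k_def by linarith+
      hence k: "a < k / 2 ^ j" "(k + 1) / 2 ^ j < b"
        using j by (simp_all add: field_simps power_one_over)
      have kk: "k / 2 ^ j < (k + 1) / 2 ^ j" by (simp add: divide_strict_right_mono)
      let ?p = "c (k / 2 ^ j)" and ?q = "c ((k + 1) / 2 ^ j)"
      have "?q \<noteq> ?p" using dyadic[of k j] dyadic[of "k + 1" j] distinct[of j k] by simp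
      hence "0 < m * norm (?q - ?p)" using m by simp
      also have "\<dots> \<le> (?q - ?p) \<bullet> T t" using k kk ab by (intro cone) auto
      finally have "0 < (?q - ?p) \<bullet> T t" .
      moreover have "0 \<le> (?p - c a) \<bullet> T t"
        using k kk ab m by (intro order_trans[OF _ cone]) auto
      moreover have "0 \<le> (c b - ?q) \<bullet> T t"
        using k kk ab m by (intro order_trans[OF _ cone]) auto
      ultimately have "c b \<noteq> c a" by (auto simp: inner_diff_left)
      thus ?thesis
        using norm_sgn_diff_le_iff[of "T t" "c b - c a" e] unit e cone[of a b] ab by (simp add: m_def)
    qed
    thus ?thesis using d(1) by blast
  qed
  have "((\<lambda>s. sgn (s - t) *\<^sub>R sgn (c s - c t)) \<longlongrightarrow> T t) (at t)"
    unfolding LIM_def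
  proof (intro allI impI)
    fix r :: real assume "0 < r"
    define e where "e = min (r / 2) (1 / 2)"
    have e: "0 < e" "e < 1" "e < r" using \<open>0 < r\<close> by (auto simp: e_def)
    obtain d where d: "d > 0" "\<And>a b. t - d < a \<Longrightarrow> a < b \<Longrightarrow> b < t + d \<Longrightarrow> norm (sgn (c b - c a) - T t) \<le> e"
      using near[OF e(1,2)] by blast
    have "dist (sgn (s - t) *\<^sub>R sgn (c s - c t)) (T t) < r" if s: "s \<noteq> t" "dist s t < d" for s
    proof (cases "s < t")
      case True
      have "norm (sgn (c t - c s) - T t) \<le> e" using s True by (intro d) (auto simp: dist_real_def)
      moreover have "sgn (s - t) *\<^sub>R sgn (c s - c t) = sgn (c t - c s)"
        using True sgn_minus[of "c t - c s"] by simp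
      ultimately show ?thesis using e by (simp add: dist_norm)
    next
      case False
      hence "norm (sgn (c s - c t) - T t) \<le> e" using s by (intro d) (auto simp: dist_real_def)
      thus ?thesis using e False s by (simp add: dist_norm)
    qed
    thus "\<exists>d>0. \<forall>s. s \<noteq> t \<and> dist s t < d \<longrightarrow> dist (sgn (s - t) *\<^sub>R sgn (c s - c t)) (T t) < r"
      using d(1) by blast
  qed
  thus ?thesis using unit by (simp add: has_tangent_direction_def)
qed

section \<open>Convergence and tangent continuity of the scheme\<close>

theorem theorem3p2:
  fixes P0 :: "int \<Rightarrow> real^3"
  assumes "geodesic_polygon P0"
  shows "(\<forall>j. geodesic_polygon (sbigs P0 j)) \<and>
    (\<exists>c :: real \<Rightarrow> real^3.
        range c \<subseteq> sphere 0 1 \<and>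
        continuous_on UNIV c \<and>
        uniform_limit UNIV (\<lambda>j. polygon_curve j (sbigs P0 j)) c sequentially \<and>
        G1_continuous c)"
proof -
  let ?P = "sbigs P0"
  define q :: real where "q = 11 / 12"
  have q: "0 \<le> q" "q < 1" by (simp_all add: q_def)
  have G: "geodesic_polygon (?P j)" for j using geodesic_polygon_sbigs[OF assms] .
  have len: "edge_length (?P j) k \<le> 4 * q ^ j" for j k
    using sbigs_edge_length_decay[OF assms] by (simp add: q_def)
  have defect: "\<bar>angular_defect (?P j) k\<bar> \<le> 5 * q ^ j" for j k
    using sbigs_angular_defect_decay[OF assms] by (simp add: q_def)
  have base: "\<bar>sbigs_base_angle (?P j) k\<bar> \<le> 5 / 4 * q ^ j" for j k
    using defect[of j k] defect[of j "k + 1"] by (simp add: sbigs_base_angle_def)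
  have pow: "q ^ Suc j \<le> q ^ j" for j using q by (simp add: mult_left_le_one_le)
  have jump_P: "norm (?P j (k + 1) - ?P j k) \<le> 4 * q ^ j" for j k
    using spherical_edge_norm_diff[OF geodesic_polygon_edge[OF G]] len[of j k]
    by (metis edge_length_def order_trans)
  have nested: "?P (Suc j) (2 * k) = ?P j k" for j k by (simp add: sbigs_Suc)
  have refine_P: "norm (?P (Suc j) k - ?P j (k div 2)) \<le> 4 * q ^ j" for j k
  proof (cases k rule: even_odd_cases_int)
    case (1 i)
    thus ?thesis using q by (simp add: nested)
  next
    case (2 i)
    thus ?thesis using jump_P[of "Suc j" "2 * i"] pow[of j] by (simp add: nested)
  qed
  obtain c :: "real \<Rightarrow> real^3" where c: "continuous_on UNIV c"
      "\<And>j t. norm (?P j \<lfloor>2 ^ j * t\<rfloor> - c t) \<le> 4 / (1 - q) * q ^ j"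
    by (rule dyadic_steps_converge[OF q refine_P jump_P]) (rule that)
  \<comment> \<open>The constant \<open>11\<close> exceeds \<open>5 + 4\<close>, needed for jumps, and \<open>5/4 + 5 + 4\<close>, needed for refinement.\<close>
  have jump_U: "norm (outgoing_dir (?P j) (k + 1) - outgoing_dir (?P j) k) \<le> 11 * q ^ j" for j k
    using outgoing_dir_jump[OF G, of j k] len[of j k] defect[of j "k + 1"] q
      zero_le_power[of q j] by linarith
  have refine_U: "norm (outgoing_dir (?P (Suc j)) k - outgoing_dir (?P j) (k div 2)) \<le> 11 * q ^ j" for j k
    using outgoing_dir_refine[OF G, of j k] base[of j "k div 2"] defect[of "Suc j" k] len[of "Suc j" "k - 1"] pow[of j]
      zero_le_power[OF q(1), of j]
    unfolding sbigs_Suc[symmetric] by linarith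
  obtain T :: "real \<Rightarrow> real^3" where T: "continuous_on UNIV T"
      "\<And>j t. norm (outgoing_dir (?P j) \<lfloor>2 ^ j * t\<rfloor> - T t) \<le> 11 / (1 - q) * q ^ j"
    by (rule dyadic_steps_converge[OF q refine_U jump_U]) (rule that)
  have zero: "(\<lambda>j. C * q ^ j) \<longlonglongrightarrow> 0" for C
    using q by (intro tendsto_mult_right_zero LIMSEQ_power_zero) simp
  have unifI: "uniform_limit UNIV f g sequentially"
    if "\<And>j t. norm (f j t - g t) \<le> C * q ^ j" for f :: "nat \<Rightarrow> real \<Rightarrow> real^3" and g C
  proof (rule uniform_limitI)
    fix e :: real assume "0 < e"
    hence "\<forall>\<^sub>F j in sequentially. C * q ^ j < e" by (intro order_tendstoD(2)[OF zero])
    thus "\<forall>\<^sub>F j in sequentially. \<forall>t\<in>UNIV. dist (f j t) (g t) < e"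
      by eventually_elim (use that in \<open>auto simp: dist_norm intro: le_less_trans\<close>)
  qed
  have lim_c: "(\<lambda>j. ?P j \<lfloor>2 ^ j * t\<rfloor>) \<longlonglongrightarrow> c t" for t
    by (rule tendsto_uniform_limitI[OF unifI[OF c(2)]]) simp
  have lim_T: "(\<lambda>j. outgoing_dir (?P j) \<lfloor>2 ^ j * t\<rfloor>) \<longlonglongrightarrow> T t" for t
    by (rule tendsto_uniform_limitI[OF unifI[OF T(2)]]) simp
  have norm_c: "norm (c t) = 1" for t
    using LIMSEQ_unique[OF tendsto_norm[OF lim_c]] outgoing_incoming_dir(1)[OF G] by simp
  have norm_T: "norm (T t) = 1" for t
    using LIMSEQ_unique[OF tendsto_norm[OF lim_T]] outgoing_incoming_dir(2)[OF G] by simp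
  have "uniform_limit UNIV (\<lambda>j. polygon_curve j (?P j)) c sequentially"
  proof (rule unifI)
    fix j and t :: real
    let ?i = "\<lfloor>2 ^ j * t\<rfloor>"
    let ?l = "edge_length (?P j) ?i"
    have l: "0 < ?l" using edge_length_bounds(1)[OF G] .
    have "norm (polygon_curve j (?P j) t - ?P j ?i) \<le> \<bar>(2 ^ j * t - ?i) * ?l\<bar>"
      using geodesic_near_start[OF geodesic_polygon_edge[OF G]] by (simp add: polygon_curve_def Let_def)
    also have "\<dots> = (2 ^ j * t - ?i) * ?l" using l by (simp add: abs_mult)
    also have "\<dots> \<le> 1 * ?l"
      using l by (intro mult_right_mono) linarith+
    also have "\<dots> \<le> 4 * q ^ j" using len by simp
    finally have "norm (polygon_curve j (?P j) t - ?P j ?i) \<le> 4 * q ^ j" .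
    hence "norm ((polygon_curve j (?P j) t - ?P j ?i) + (?P j ?i - c t)) \<le> 4 * q ^ j + 4 / (1 - q) * q ^ j"
      using c(2) by (intro norm_triangle_mono)
    thus "norm (polygon_curve j (?P j) t - c t) \<le> (4 + 4 / (1 - q)) * q ^ j"
      by (simp add: distrib_right)
  qed
  moreover have "uniform_limit UNIV (\<lambda>j t. sgn (?P j (\<lfloor>2 ^ j * t\<rfloor> + 1) - ?P j \<lfloor>2 ^ j * t\<rfloor>)) T sequentially"
  proof (rule unifI)
    fix j and t :: real
    let ?i = "\<lfloor>2 ^ j * t\<rfloor>"
    let ?u = "sgn (?P j (?i + 1) - ?P j ?i)"
    have "norm (?u - outgoing_dir (?P j) ?i) \<le> 4 * q ^ j"
      using chord_near_start_dir[OF geodesic_polygon_edge[OF G]] len[of j ?i]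
      by (metis outgoing_dir_eq[OF G] edge_length_def order_trans)
    hence "norm ((?u - outgoing_dir (?P j) ?i) + (outgoing_dir (?P j) ?i - T t)) \<le> 4 * q ^ j + 11 / (1 - q) * q ^ j"
      using T(2) by (intro norm_triangle_mono)
    thus "norm (?u - T t) \<le> (4 + 11 / (1 - q)) * q ^ j" by (simp add: distrib_right)
  qed
  hence "has_tangent_direction c (T t) t" for t
    using G by (intro dyadic_tangent_direction[OF nested _ lim_c _ T(1) norm_T]) (auto simp: geodesic_polygon_def)
  hence "G1_continuous c" using T(1) by (auto simp: G1_continuous_def)
  ultimately show ?thesis
    using G c(1) norm_c by (intro conjI exI[of _ c]) auto
qed

end
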